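(* Let $f:2^U\to\mathbb{R}_{\ge0}$ be monotone submodular, $U$ partitioned into $U_1,\dots,U_N$, and $k_1,\dots,k_N$ positive integers with $k_j\le|U_j|$ and $\min_ik_i\ge4$. Let $\mathcal{P}=\{S\subseteq U:|S\cap U_j|\le k_j\ \forall j\in[N]\}$, $\phi=\lfloor\sqrt{\min_{i\in[N]}k_i}\rfloor-1$ and $r_j=\lfloor k_j/\phi\rfloor$. If Block-Greedy with subroutine Greedy-Subroutine-Mono (described in the context) is run, its output $S$ satisfies $f(S)\ge(1-1/e-\frac{1}{\phi+1})f(OPT)$, where $OPT\in\arg\max_{S\in\mathcal{P}}f(S)$.
   Context: $f$ submodular: $f(A\cup\{x\})-f(A)\ge f(B\cup\{x\})-f(B)$ for $A\subseteq B\subseteq U$, $x\notin B$; monotone: $f(X)\le f(Y)$ for $X\subseteq Y$; $\Delta f(S,x)=f(S\cup\{x\})-f(S)$. Block-Greedy with Greedy-Subroutine-Mono: $S\gets\emptyset$; for $i=1,\dots,\phi$: for $j=1,\dots,N$: repeat $r_j$ times: $S\gets S\cup\{\arg\max_{x\in U_j}\Delta f(S,x)\}$. Return $S$. *)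

theory Defs
  imports Complex_Main "HOL-Library.Disjoint_Sets"
begin

text \<open>
  A set function on the finite ground set \<open>U\<close> is a total function \<open>'a set \<Rightarrow> real\<close> of which
  only the values on subsets of \<open>U\<close> matter.
\<close>

definition marginal :: "('a set \<Rightarrow> real) \<Rightarrow> 'a set \<Rightarrow> 'a \<Rightarrow> real" where
  "marginal f S x = f (S \<union> {x}) - f S"

definition submodular_on :: "'a set \<Rightarrow> ('a set \<Rightarrow> real) \<Rightarrow> bool" where
  "submodular_on U f \<longleftrightarrow>
     (\<forall>A B x. A \<subseteq> B \<and> B \<subseteq> U \<and> x \<in> U \<and> x \<notin> B \<longrightarrow>
        f (A \<union> {x}) - f A \<ge> f (B \<union> {x}) - f B)"

text \<open>The feasible family of the partition matroid with blocks \<open>V 1, \<dots>, V N\<close> and capacities \<open>k\<close>.\<close>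

definition partition_feasible :: "'a set \<Rightarrow> nat \<Rightarrow> (nat \<Rightarrow> 'a set) \<Rightarrow> (nat \<Rightarrow> nat) \<Rightarrow> 'a set set" where
  "partition_feasible U N V k = {S. S \<subseteq> U \<and> (\<forall>j\<in>{1..N}. card (S \<inter> V j) \<le> k j)}"

text \<open>
  The algorithms are relations between the set before and the set after execution, since the
  choice among several maximisers is left open.  The maximum ranges over all of \<open>V\<close>, elements
  already chosen included, so a step may leave the set unchanged.
\<close>

definition greedy_step :: "('a set \<Rightarrow> real) \<Rightarrow> 'a set \<Rightarrow> 'a set \<Rightarrow> 'a set \<Rightarrow> bool" where
  "greedy_step f V S S' \<longleftrightarrow>
     (\<exists>x. is_arg_max (marginal f S) (\<lambda>x. x \<in> V) x \<and> S' = S \<union> {x})"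

text \<open>One pass over the blocks \<open>V 1, \<dots>, V N\<close> in this order, with \<open>r j\<close> greedy steps in block \<open>j\<close>.\<close>

primrec greedy_subroutine_mono ::
  "('a set \<Rightarrow> real) \<Rightarrow> (nat \<Rightarrow> 'a set) \<Rightarrow> (nat \<Rightarrow> nat) \<Rightarrow> nat \<Rightarrow> 'a set \<Rightarrow> 'a set \<Rightarrow> bool" where
  "greedy_subroutine_mono f V r 0 = (=)"
| "greedy_subroutine_mono f V r (Suc n) =
     greedy_subroutine_mono f V r n OO (greedy_step f (V (Suc n)) ^^ r (Suc n))"

definition block_greedy :: "('a set \<Rightarrow> 'a set \<Rightarrow> bool) \<Rightarrow> nat \<Rightarrow> 'a set \<Rightarrow> bool" where
  "block_greedy subroutine \<phi> S \<longleftrightarrow> (subroutine ^^ \<phi>) {} S"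

text \<open>Every run on finite nonempty blocks can be completed.\<close>

lemma relpowp_total:
  fixes R :: "'b \<Rightarrow> 'b \<Rightarrow> bool"
  assumes "\<And>S. \<exists>S'. R S S'"
  shows "\<exists>S'. (R ^^ n) S S'"
proof (induction n)
  case (Suc n)
  then obtain T where "(R ^^ n) S T" ..
  moreover obtain S' where "R T S'" using assms by blast
  ultimately show ?case by (blast intro: relpowp_Suc_I)
qed simp

lemma greedy_step_total:
  assumes "finite V" "V \<noteq> {}"
  shows "\<exists>S'. greedy_step f V S S'"
proof -
  have "Max (marginal f S ` V) \<in> marginal f S ` V" using assms by simp
  then obtain x where x: "x \<in> V" "Max (marginal f S ` V) = marginal f S x" by blast
  have "\<not> marginal f S x < marginal f S y" if "y \<in> V" for y
  proof -
    have "marginal f S y \<le> Max (marginal f S ` V)" using assms(1) that by simp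
    then show ?thesis using x(2) by simp
  qed
  then have "is_arg_max (marginal f S) (\<lambda>x. x \<in> V) x"
    using x(1) unfolding is_arg_max_def by blast
  then show ?thesis unfolding greedy_step_def by blast
qed

lemma greedy_subroutine_mono_total:
  assumes "\<And>j. j \<in> {1..N} \<Longrightarrow> finite (V j) \<and> V j \<noteq> {}"
  shows "\<exists>S'. greedy_subroutine_mono f V r N S S'"
  using assms
proof (induction N)
  case (Suc n)
  have "\<exists>T. greedy_subroutine_mono f V r n S T"
    by (rule Suc.IH) (simp add: Suc.prems)
  then obtain T where T: "greedy_subroutine_mono f V r n S T" ..
  have "finite (V (Suc n))" "V (Suc n) \<noteq> {}" using Suc.prems[of "Suc n"] by simp_all
  then have "\<exists>S'. (greedy_step f (V (Suc n)) ^^ r (Suc n)) T S'"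
    by (intro relpowp_total greedy_step_total)
  with T show ?case unfolding greedy_subroutine_mono.simps by (blast intro: relcomppI)
qed simp

lemma block_greedy_has_output:
  assumes "\<And>j. j \<in> {1..N} \<Longrightarrow> finite (V j) \<and> V j \<noteq> {}"
  shows "\<exists>S. block_greedy (greedy_subroutine_mono f V r N) \<phi> S"
  unfolding block_greedy_def by (intro relpowp_total greedy_subroutine_mono_total assms)

end

theory Submission imports Defs begin

text \<open>
  Let \<open>T\<close> be the set after a pass. By submodularity each of the \<open>r j\<close> greedy steps in block \<open>j\<close>
  gains at least \<open>marginal f T x\<close> for every \<open>x \<in> OPT \<inter> V j\<close>. Since
  \<open>card (OPT \<inter> V j) \<le> k j \<le> (\<phi> + 1) * r j\<close>, the whole pass gains at least
  \<open>1 / (\<phi> + 1)\<close> times the sum of these marginals, hence at least \<open>(f OPT - f T) / (\<phi> + 1)\<close>.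
  So a pass shrinks the gap to \<open>f OPT\<close> by the factor \<open>(\<phi> + 1) / (\<phi> + 2)\<close>, and the
  \<open>\<phi>\<close>-th power of this factor is at most \<open>1 / e + 1 / (\<phi> + 1)\<close>.
\<close>

section \<open>Marginals of monotone submodular functions\<close>

locale monotone_submodular =
  fixes U :: "'a set" and f :: "'a set \<Rightarrow> real"
  assumes finite_ground: "finite U"
    and mono_f: "mono_on (Pow U) f"
    and submodular_f: "submodular_on U f"
begin

lemma f_mono: "A \<subseteq> B \<Longrightarrow> B \<subseteq> U \<Longrightarrow> f A \<le> f B"
  by (rule mono_onD[OF mono_f]) auto

lemma marginal_nonneg: "T \<subseteq> U \<Longrightarrow> x \<in> U \<Longrightarrow> 0 \<le> marginal f T x"
  using f_mono[of T "T \<union> {x}"] by (auto simp: marginal_def)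

text \<open>Submodularity is only postulated for \<open>x\<close> outside the larger set. For
  \<open>x \<in> T\<close> the left side is 0 and monotonicity takes over.\<close>

lemma marginal_antimono:
  assumes "S \<subseteq> T" "T \<subseteq> U" "x \<in> U"
  shows "marginal f T x \<le> marginal f S x"
proof (cases "x \<in> T")
  case True
  then have "marginal f T x = 0" by (simp add: marginal_def insert_absorb)
  then show ?thesis using assms marginal_nonneg[of S x] by auto
next
  case False
  then show ?thesis
    using submodular_f assms unfolding submodular_on_def marginal_def by blast
qed

text \<open>Adding \<open>A\<close> one element at a time telescopes the left side, and each
  increment is at most its marginal at \<open>T\<close>.\<close>

lemma union_le_sum_marginal:
  assumes "T \<subseteq> U" "A \<subseteq> U"
  shows "f (T \<union> A) - f T \<le> (\<Sum>x\<in>A. marginal f T x)"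
proof -
  have "finite A" using assms finite_ground finite_subset by blast
  then show ?thesis using assms(2)
  proof (induction A rule: finite_induct)
    case (insert x A)
    have "marginal f (T \<union> A) x \<le> marginal f T x"
      using insert.prems assms(1) by (intro marginal_antimono) auto
    then show ?case using insert by (simp add: marginal_def)
  qed simp
qed

section \<open>Gain of the greedy steps, of a pass, and of the whole run\<close>

text \<open>Each step beats every \<open>x \<in> W\<close> at the current set, hence also at any
  later \<open>T\<close>. Leaving \<open>T\<close> free allows the gains of different blocks to be
  compared at one common set, the end of the pass.\<close>

lemma greedy_steps_gain:
  assumes "(greedy_step f W ^^ n) S S'" "S \<subseteq> U" "W \<subseteq> U"
  shows "S \<subseteq> S' \<and> S' \<subseteq> U \<and>
    (\<forall>T x. S' \<subseteq> T \<and> T \<subseteq> U \<and> x \<in> W \<longrightarrow> real n * marginal f T x \<le> f S' - f S)"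
  using assms(1)
proof (induction n arbitrary: S')
  case 0
  then show ?case using assms(2) by simp
next
  case (Suc n)
  then obtain R where R: "(greedy_step f W ^^ n) S R" and "greedy_step f W R S'" by auto
  then obtain y where y: "is_arg_max (marginal f R) (\<lambda>x. x \<in> W) y" and S': "S' = R \<union> {y}"
    unfolding greedy_step_def by blast
  have sub: "S \<subseteq> R" "R \<subseteq> U"
    and IH: "\<And>T x. R \<subseteq> T \<Longrightarrow> T \<subseteq> U \<Longrightarrow> x \<in> W \<Longrightarrow> real n * marginal f T x \<le> f R - f S"
    using Suc.IH[OF R] by simp_all
  have "y \<in> W" using y by (simp add: is_arg_max_def)
  have "real (Suc n) * marginal f T x \<le> f S' - f S" if "S' \<subseteq> T" "T \<subseteq> U" "x \<in> W" for T x
  proof -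
    have "real n * marginal f T x \<le> f R - f S"
      using that S' by (intro IH) auto
    moreover have "marginal f T x \<le> marginal f R x"
      using that S' assms(3) by (intro marginal_antimono) auto
    moreover have "\<not> marginal f R y < marginal f R x"
      using y that(3) by (simp add: is_arg_max_def)
    ultimately show ?thesis by (simp add: S' marginal_def algebra_simps)
  qed
  then show ?case using sub \<open>y \<in> W\<close> S' assms(3) by blast
qed

text \<open>Each marginal is at most the average gain per step, and the \<open>n\<close> steps pay
  for a fraction \<open>c\<close> of the elements of \<open>A\<close>.\<close>

lemma greedy_steps_gain_sum:
  assumes "(greedy_step f W ^^ n) S S'" "S \<subseteq> U" "W \<subseteq> U"
    and "S' \<subseteq> T" "T \<subseteq> U" "A \<subseteq> W" "n > 0" "0 \<le> c" "c * real (card A) \<le> real n"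
  shows "c * (\<Sum>x\<in>A. marginal f T x) \<le> f S' - f S"
proof -
  note gain = greedy_steps_gain[OF assms(1-3)]
  have "marginal f T x \<le> (f S' - f S) / real n" if "x \<in> A" for x
    using gain that assms by (auto simp: pos_le_divide_eq mult.commute)
  then have "(\<Sum>x\<in>A. marginal f T x) \<le> real (card A) * ((f S' - f S) / real n)"
    by (rule sum_bounded_above)
  then have "c * (\<Sum>x\<in>A. marginal f T x) \<le> c * (real (card A) * ((f S' - f S) / real n))"
    using \<open>0 \<le> c\<close> by (rule mult_left_mono)
  also have "\<dots> = c * real (card A) * ((f S' - f S) / real n)" by simp
  \<comment> \<open>The average gain is nonnegative by monotonicity, so
    \<open>c * real (card A)\<close> may be replaced by \<open>real n\<close>.\<close>
  also have "\<dots> \<le> real n * ((f S' - f S) / real n)"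
    using assms(9) gain f_mono[of S S'] by (intro mult_right_mono) auto
  finally show ?thesis using \<open>n > 0\<close> by simp
qed

lemma greedy_subroutine_mono_gain:
  assumes "greedy_subroutine_mono f V r n S S'" "S \<subseteq> U"
    and "\<And>j. j \<in> {1..n} \<Longrightarrow> V j \<subseteq> U"
    and "\<And>j. j \<in> {1..n} \<Longrightarrow> r j > 0 \<and> c * real (card (A \<inter> V j)) \<le> real (r j)"
    and "0 \<le> c"
  shows "S \<subseteq> S' \<and> S' \<subseteq> U \<and>
    (\<forall>T. S' \<subseteq> T \<and> T \<subseteq> U \<longrightarrow>
      c * (\<Sum>j\<in>{1..n}. \<Sum>x\<in>A \<inter> V j. marginal f T x) \<le> f S' - f S)"
  using assms(1,3,4)
proof (induction n arbitrary: S')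
  case 0
  then show ?case using assms(2) by simp
next
  case (Suc n)
  then obtain R where R: "greedy_subroutine_mono f V r n S R"
    and steps: "(greedy_step f (V (Suc n)) ^^ r (Suc n)) R S'" by auto
  have IH: "S \<subseteq> R \<and> R \<subseteq> U \<and> (\<forall>T. R \<subseteq> T \<and> T \<subseteq> U \<longrightarrow>
      c * (\<Sum>j\<in>{1..n}. \<Sum>x\<in>A \<inter> V j. marginal f T x) \<le> f R - f S)"
    using Suc.prems by (intro Suc.IH[OF R]) auto
  have V: "V (Suc n) \<subseteq> U" using Suc.prems(2) by simp
  have S': "R \<subseteq> S' \<and> S' \<subseteq> U"
    using greedy_steps_gain[OF steps _ V] IH by blast
  have "c * (\<Sum>j\<in>{1..Suc n}. \<Sum>x\<in>A \<inter> V j. marginal f T x) \<le> f S' - f S"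
    if T: "S' \<subseteq> T" "T \<subseteq> U" for T
  proof -
    have "c * (\<Sum>j\<in>{1..n}. \<Sum>x\<in>A \<inter> V j. marginal f T x) \<le> f R - f S"
      using IH S' T by blast
    moreover have "c * (\<Sum>x\<in>A \<inter> V (Suc n). marginal f T x) \<le> f S' - f R"
      using Suc.prems(3)[of "Suc n"] IH T V assms(5)
      by (intro greedy_steps_gain_sum[OF steps]) auto
    ultimately show ?thesis by (simp add: algebra_simps)
  qed
  then show ?case using IH S' by blast
qed

text \<open>Taking \<open>T = S'\<close> bounds the gain of the pass below by \<open>c\<close> times
  the gap that remains after it; solving for that gap yields the factor
  \<open>1 / (1 + c)\<close>.\<close>

lemma greedy_subroutine_mono_gap:
  assumes "greedy_subroutine_mono f V r N S S'" "S \<subseteq> U"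
    and "(\<Union>j\<in>{1..N}. V j) = U" "disjoint_family_on V {1..N}" "A \<subseteq> U"
    and "\<And>j. j \<in> {1..N} \<Longrightarrow> r j > 0 \<and> c * real (card (A \<inter> V j)) \<le> real (r j)"
    and "0 \<le> c"
  shows "S' \<subseteq> U" and "f A - f S' \<le> (f A - f S) / (1 + c)"
proof -
  have gain: "S \<subseteq> S' \<and> S' \<subseteq> U \<and> (\<forall>T. S' \<subseteq> T \<and> T \<subseteq> U \<longrightarrow>
      c * (\<Sum>j\<in>{1..N}. \<Sum>x\<in>A \<inter> V j. marginal f T x) \<le> f S' - f S)"
    using assms(3,6,7) by (intro greedy_subroutine_mono_gain[OF assms(1,2)]) auto
  then show S': "S' \<subseteq> U" by blast
  have fin: "finite A" using assms(5) finite_ground finite_subset by blast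
  have A: "A = (\<Union>j\<in>{1..N}. A \<inter> V j)" using assms(3,5) by auto
  have "(\<Sum>x\<in>(\<Union>j\<in>{1..N}. A \<inter> V j). marginal f S' x) =
      (\<Sum>j\<in>{1..N}. \<Sum>x\<in>A \<inter> V j. marginal f S' x)"
    using fin assms(4) by (intro sum.UNION_disjoint) (auto simp: disjoint_family_on_def)
  then have "c * (\<Sum>x\<in>A. marginal f S' x) \<le> f S' - f S"
    using gain A by simp
  \<comment> \<open>Monotonicity replaces \<open>f (S' \<union> A)\<close> by the smaller
    \<open>f A\<close>.\<close>
  moreover have "f A - f S' \<le> (\<Sum>x\<in>A. marginal f S' x)"
    using union_le_sum_marginal[OF S' assms(5)] f_mono[of A "S' \<union> A"] S' assms(5) by simp
  ultimately have "c * (f A - f S') \<le> f S' - f S"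
    using assms(7) by (meson mult_left_mono order_trans)
  then show "f A - f S' \<le> (f A - f S) / (1 + c)"
    using assms(7) by (subst pos_le_divide_eq) (auto simp: algebra_simps)
qed

lemma block_greedy_mono_gap:
  assumes "block_greedy (greedy_subroutine_mono f V r N) m S"
    and "(\<Union>j\<in>{1..N}. V j) = U" "disjoint_family_on V {1..N}" "A \<subseteq> U"
    and "\<And>j. j \<in> {1..N} \<Longrightarrow> r j > 0 \<and> c * real (card (A \<inter> V j)) \<le> real (r j)"
    and "0 \<le> c"
  shows "f A - f S \<le> (f A - f {}) / (1 + c) ^ m"
proof -
  have "(greedy_subroutine_mono f V r N ^^ m) {} S"
    using assms(1) by (simp add: block_greedy_def)
  \<comment> \<open>The inclusion is carried along because the next pass must start inside
    \<open>U\<close>.\<close>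
  then have "S \<subseteq> U \<and> f A - f S \<le> (f A - f {}) / (1 + c) ^ m"
  proof (induction m arbitrary: S)
    case (Suc m)
    then obtain R where R: "(greedy_subroutine_mono f V r N ^^ m) {} R"
      and pass: "greedy_subroutine_mono f V r N R S" by auto
    note IH = Suc.IH[OF R]
    have "S \<subseteq> U" and gap: "f A - f S \<le> (f A - f R) / (1 + c)"
      using greedy_subroutine_mono_gap[OF pass _ assms(2-4) assms(5,6)] IH by auto
    have "(f A - f R) / (1 + c) \<le> (f A - f {}) / (1 + c) ^ m / (1 + c)"
      using IH assms(6) by (intro divide_right_mono) auto
    then show ?case using \<open>S \<subseteq> U\<close> gap by (simp add: mult.commute)
  qed simp
  then show ?thesis by blast
qed

end

section \<open>Numerical estimates\<close>

text \<open>With \<open>x = 1 / (m + 1)\<close>, two extra factors raise the power above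
  \<open>e\<close>. Removing them costs \<open>(1 + x)\<^sup>2\<close>, whose excess over 1 is
  \<open>x * (2 + x)\<close>, and \<open>2 + x \<le> 5 / 2 \<le> e\<close>.\<close>

lemma inverse_power_le_exp:
  fixes m :: nat
  assumes "m \<ge> 1"
  shows "1 / (1 + 1 / (real m + 1)) ^ m \<le> 1 / exp 1 + 1 / (real m + 1)"
proof -
  define x where "x = 1 / (real m + 1)"
  have x: "0 < x" "x \<le> 1 / 2" using assms by (auto simp: x_def field_simps)
  have e: "exp 1 \<ge> (5 / 2 :: real)"
    using exp_lower_Taylor_quadratic[of 1] by simp
  \<comment> \<open>The exponent \<open>m + 2\<close> fits because
    \<open>1 / (1 + x) = 1 - 1 / (m + 2)\<close>, which is at most
    \<open>exp (- 1 / (m + 2))\<close>.\<close>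
  have "exp 1 \<le> (1 + x) ^ (m + 2)"
  proof -
    have "1 / (1 + x) = 1 - 1 / (real m + 2)"
      by (simp add: x_def field_simps)
    also have "\<dots> \<le> exp (- 1 / (real m + 2))"
      using exp_ge_add_one_self[of "- 1 / (real m + 2)"] by simp
    finally have "(1 / (1 + x)) ^ (m + 2) \<le> exp (- 1 / (real m + 2)) ^ (m + 2)"
      using x by (intro power_mono) auto
    also have "\<dots> = exp (real (m + 2) * (- 1 / (real m + 2)))"
      by (rule exp_of_nat_mult[symmetric])
    also have "real (m + 2) * (- 1 / (real m + 2)) = - 1"
      by (simp add: field_simps)
    finally have "inverse ((1 + x) ^ (m + 2)) \<le> inverse (exp 1)"
      by (simp only: power_one_over exp_minus inverse_eq_divide)
    moreover have "0 < (1 + x) ^ (m + 2)" using x by (intro zero_less_power) simp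
    ultimately show ?thesis by (rule inverse_le_imp_le)
  qed
  then have "exp 1 \<le> (1 + x)\<^sup>2 * (1 + x) ^ m"
    by (simp only: power_add mult.commute)
  moreover have "0 < (1 + x) ^ m" using x by (intro zero_less_power) simp
  ultimately have "1 / (1 + x) ^ m \<le> (1 + x)\<^sup>2 / exp 1"
    by (simp add: pos_divide_le_eq pos_le_divide_eq)
  also have "\<dots> = 1 / exp 1 + x * (2 + x) / exp 1"
    by (simp add: field_simps power2_eq_square)
  also have "x * (2 + x) / exp 1 \<le> x"
    using x e by (simp add: pos_divide_le_eq)
  finally show ?thesis by (simp add: x_def)
qed

text \<open>The remainder is below \<open>m\<close>, and \<open>m\<close> is at most the quotient,
  so one more quotient absorbs it.\<close>

lemma le_Suc_mult_div:
  fixes k m :: nat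
  assumes "m\<^sup>2 \<le> k" "m > 0"
  shows "k \<le> (m + 1) * (k div m)"
proof -
  have "m \<le> k div m"
    using assms by (simp add: less_eq_div_iff_mult_less_eq power2_eq_square)
  moreover have "k mod m < m" using assms(2) by simp
  moreover have "k = m * (k div m) + k mod m" by simp
  ultimately show ?thesis by (simp only: distrib_right)
qed

theorem theorem7:
  fixes U :: "'a set" and f :: "'a set \<Rightarrow> real"
    and N \<phi> :: nat and V :: "nat \<Rightarrow> 'a set" and k r :: "nat \<Rightarrow> nat"
    and S OPT :: "'a set"
  assumes "finite U"
    and "\<And>X. X \<subseteq> U \<Longrightarrow> f X \<ge> 0"
    and "mono_on (Pow U) f"
    and "submodular_on U f"
    and "N \<ge> 1"
    and "(\<Union>j\<in>{1..N}. V j) = U"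
    and "disjoint_family_on V {1..N}"
    and "\<And>j. j \<in> {1..N} \<Longrightarrow> 0 < k j \<and> k j \<le> card (V j)"
    and "Min (k ` {1..N}) \<ge> 4"
    and "\<phi> = nat (\<lfloor>sqrt (real (Min (k ` {1..N})))\<rfloor> - 1)"
    and "\<And>j. j \<in> {1..N} \<Longrightarrow> r j = nat \<lfloor>real (k j) / real \<phi>\<rfloor>"
    and "block_greedy (greedy_subroutine_mono f V r N) \<phi> S"
    and "is_arg_max f (\<lambda>X. X \<in> partition_feasible U N V k) OPT"
  shows "f S \<ge> (1 - 1 / exp 1 - 1 / (real \<phi> + 1)) * f OPT"
proof -
  interpret monotone_submodular U f
    using assms(1,3,4) by unfold_locales
  define mk where "mk = Min (k ` {1..N})"
  have mk: "mk \<ge> 4" "\<And>j. j \<in> {1..N} \<Longrightarrow> mk \<le> k j"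
    using assms(9) by (auto simp: mk_def)
  \<comment> \<open>The bound 4 on the capacities ensures \<open>\<phi> \<ge> 1\<close>, so
    \<open>nat\<close> truncates nothing and the division by \<open>\<phi>\<close> is
    genuine.\<close>
  have "2 \<le> sqrt (real mk)" using mk(1) by (intro real_le_rsqrt) simp
  then have "2 \<le> \<lfloor>sqrt (real mk)\<rfloor>" by (simp add: le_floor_iff)
  moreover have "\<phi> = nat (\<lfloor>sqrt (real mk)\<rfloor> - 1)"
    using assms(10) by (simp only: mk_def)
  ultimately have \<phi>: "\<phi> \<ge> 1" "real \<phi> \<le> sqrt (real mk)"
    by linarith+
  have "(real \<phi>)\<^sup>2 \<le> real mk"
    using power_mono[OF \<phi>(2), of 2] by simp
  then have sq: "\<phi>\<^sup>2 \<le> mk" by (metis of_nat_le_iff of_nat_power)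
  have OPT: "OPT \<subseteq> U" "\<And>j. j \<in> {1..N} \<Longrightarrow> card (OPT \<inter> V j) \<le> k j"
    using assms(13) by (auto simp: is_arg_max_def partition_feasible_def)
  define c where "c = 1 / (real \<phi> + 1)"
  have r: "r j > 0 \<and> c * real (card (OPT \<inter> V j)) \<le> real (r j)" if j: "j \<in> {1..N}" for j
  proof -
    have r: "r j = k j div \<phi>"
      using assms(11)[OF j] by (simp add: floor_divide_of_nat_eq)
    have "k j \<le> (\<phi> + 1) * r j"
      unfolding r using sq mk(2)[OF j] \<phi>(1) by (intro le_Suc_mult_div) auto
    moreover have "k j > 0" using assms(8)[OF j] by simp
    \<comment> \<open>If \<open>r j\<close> were 0, the bound would force
      \<open>k j = 0\<close>.\<close>
    ultimately have "r j > 0" and "card (OPT \<inter> V j) \<le> (\<phi> + 1) * r j"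
      using OPT(2)[OF j] by (auto intro: Nat.gr0I)
    from this(2) have "real (card (OPT \<inter> V j)) \<le> real ((\<phi> + 1) * r j)"
      by (simp only: of_nat_le_iff)
    then show ?thesis
      using \<open>r j > 0\<close> by (simp add: c_def pos_divide_le_eq algebra_simps)
  qed
  have "f OPT - f S \<le> (f OPT - f {}) / (1 + c) ^ \<phi>"
    using r by (intro block_greedy_mono_gap[OF assms(12,6,7) OPT(1)]) (auto simp: c_def)
  \<comment> \<open>Nonnegativity of \<open>f {}\<close> allows this term to be dropped.\<close>
  also have "\<dots> \<le> f OPT / (1 + c) ^ \<phi>"
    using assms(2)[of "{}"] by (intro divide_right_mono) (auto simp: c_def)
  also have "\<dots> = f OPT * (1 / (1 + c) ^ \<phi>)" by simp
  also have "\<dots> \<le> f OPT * (1 / exp 1 + 1 / (real \<phi> + 1))"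
    using inverse_power_le_exp[OF \<phi>(1)] assms(2)[OF OPT(1)]
    unfolding c_def by (rule mult_left_mono)
  finally show ?thesis by (simp add: algebra_simps)
qed

end
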